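(* Let $N\ge 1$, let $\alpha=(\alpha_{\omega})_{\omega\in I^N}$ be a family of continuous functions $\alpha_\omega:SG\to\mathbb{R}$ with $\|\alpha_\omega\|_\infty<1$, and let $L:\mathcal{C}(SG)\to\mathcal{C}(SG)$ be a bounded linear operator such that $(Lf)|_{V_0}=f|_{V_0}$ for all $f\in\mathcal{C}(SG)$. If $\|\alpha\|_\infty<\|L\|^{-1}$, then the $\alpha$-fractal operator $\mathcal{F}^\alpha:\mathcal{C}(SG)\to\mathcal{C}(SG)$, $\mathcal{F}^\alpha(f)=f^\alpha$ (with base function $b=Lf$), is a topological isomorphism (a linear bijection that is bounded with bounded inverse).
   Context: Let $V_0=\{p_1,p_2,p_3\}$ be the vertices of an equilateral triangle in $\mathbb{R}^2$, $L_i(t)=\frac12(t+p_i)$ for $i\in I=\{1,2,3\}$, and let $SG$ (the Sierpiński gasket) be the unique nonempty compact set with $SG=\bigcup_{i=1}^3L_i(SG)$. For a word $\omega=\omega_1\cdots\omega_N\in I^N$ put $L_\omega=L_{\omega_1}\circ\cdots\circ L_{\omega_N}$. $\mathcal{C}(SG)$ is the Banach space of continuous real-valued functions on $SG$ with the sup norm $\|\cdot\|_\infty$; $\|L\|$ is the operator norm. Set $\|\alpha\|_\infty=\max_{\omega\in I^N}\|\alpha_\omega\|_\infty$. For $f\in\mathcal{C}(SG)$, the $\alpha$-fractal function $f^\alpha$ with base function $b=Lf$ is the unique continuous function on $SG$ satisfying, for all $\omega\in I^N$ and $t\in L_\omega(SG)$, $$f^\alpha(t)=f(t)+\alpha_\omega(L_\omega^{-1}(t))\,\big(f^\alpha-Lf\big)(L_\omega^{-1}(t)).$$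 *)

theory Defs
  imports "HOL-Analysis.Analysis"
begin

section \<open>The Sierpinski gasket\<close>

text \<open>The index set \<open>I = {1, 2, 3}\<close> is the three-element type \<^typ>\<open>3\<close>; its elements are
  \<open>1\<close>, \<open>2\<close> and \<open>3\<close> (where \<open>3 = 0\<close>). The vertex set is \<open>V\<^sub>0 = range p\<close>.\<close>

definition equilateral :: "(3 \<Rightarrow> real^2) \<Rightarrow> bool" where
  "equilateral p \<longleftrightarrow> (\<exists>s>0. \<forall>i j. i \<noteq> j \<longrightarrow> dist (p i) (p j) = s)"

definition sg_map :: "(3 \<Rightarrow> real^2) \<Rightarrow> 3 \<Rightarrow> real^2 \<Rightarrow> real^2" where
  "sg_map p i t = (1/2) *\<^sub>R (t + p i)"

definition SG :: "(3 \<Rightarrow> real^2) \<Rightarrow> (real^2) set" where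
  "SG p = (THE K. compact K \<and> K \<noteq> {} \<and> K = (\<Union>i. sg_map p i ` K))"

definition words :: "nat \<Rightarrow> 3 list set" where
  "words N = {w. length w = N}"

text \<open>The first letter of the word is the outermost map.\<close>

definition sg_word :: "(3 \<Rightarrow> real^2) \<Rightarrow> 3 list \<Rightarrow> real^2 \<Rightarrow> real^2" where
  "sg_word p w = foldr (\<lambda>i h. sg_map p i \<circ> h) w id"


section \<open>The Banach space of continuous functions on a compact set\<close>

text \<open>Since the gasket depends on the vertices, \<open>C(S)\<close> is a carrier set rather than a type.
  Extensionality makes its elements correspond one-to-one to the continuous functions
  on \<open>S\<close>; hence the vector space operations are restricted to \<open>S\<close>.\<close>

definition cspace :: "'a::topological_space set \<Rightarrow> ('a \<Rightarrow> real) set" where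
  "cspace S = {f \<in> extensional S. continuous_on S f}"

definition sup_norm :: "'a set \<Rightarrow> ('a \<Rightarrow> real) \<Rightarrow> real" where
  "sup_norm S f = (SUP t\<in>S. \<bar>f t\<bar>)"

definition linear_cspace ::
    "'a::topological_space set \<Rightarrow> (('a \<Rightarrow> real) \<Rightarrow> ('a \<Rightarrow> real)) \<Rightarrow> bool" where
  "linear_cspace S T \<longleftrightarrow> T \<in> cspace S \<rightarrow> cspace S \<and>
     (\<forall>f\<in>cspace S. \<forall>g\<in>cspace S. T (\<lambda>t\<in>S. f t + g t) = (\<lambda>t\<in>S. T f t + T g t)) \<and>
     (\<forall>c. \<forall>f\<in>cspace S. T (\<lambda>t\<in>S. c * f t) = (\<lambda>t\<in>S. c * T f t))"

definition bounded_linear_cspace ::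
    "'a::topological_space set \<Rightarrow> (('a \<Rightarrow> real) \<Rightarrow> ('a \<Rightarrow> real)) \<Rightarrow> bool" where
  "bounded_linear_cspace S T \<longleftrightarrow> linear_cspace S T \<and>
     (\<exists>K. \<forall>f\<in>cspace S. sup_norm S (T f) \<le> K * sup_norm S f)"

text \<open>As in \<^const>\<open>onorm\<close>, the zero function contributes \<open>0 / 0 = 0\<close>.\<close>

definition op_norm ::
    "'a::topological_space set \<Rightarrow> (('a \<Rightarrow> real) \<Rightarrow> ('a \<Rightarrow> real)) \<Rightarrow> real" where
  "op_norm S T = (SUP f\<in>cspace S. sup_norm S (T f) / sup_norm S f)"

definition topological_isomorphism_cspace ::
    "'a::topological_space set \<Rightarrow> (('a \<Rightarrow> real) \<Rightarrow> ('a \<Rightarrow> real)) \<Rightarrow> bool" where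
  "topological_isomorphism_cspace S T \<longleftrightarrow>
     bij_betw T (cspace S) (cspace S) \<and> bounded_linear_cspace S T \<and>
     bounded_linear_cspace S (inv_into (cspace S) T)"

text \<open>Agreement with the metric space of continuous functions of the library.\<close>

lemma cspace_eq_cfunspace:
  assumes "compact S"
  shows "cspace S = mspace (cfunspace (top_of_set S) euclidean_metric)"
proof -
  have "bounded (f ` S)" if "continuous_on S f" for f :: "'a \<Rightarrow> real"
    using that assms by (intro compact_imp_bounded compact_continuous_image)
  then show ?thesis
    by (auto simp: cspace_def)
qed

lemma sup_norm_diff_eq_mdist:
  assumes "compact S" "S \<noteq> {}" "f \<in> cspace S" "g \<in> cspace S"
  shows "sup_norm S (\<lambda>t\<in>S. f t - g t) = mdist (cfunspace (top_of_set S) euclidean_metric) f g"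
proof -
  have "f \<in> mspace (funspace S euclidean_metric)" "g \<in> mspace (funspace S euclidean_metric)"
    using assms cfunspace_subset_funspace[of "top_of_set S" euclidean_metric]
    by (auto simp only: cspace_eq_cfunspace topspace_euclidean_subtopology)
  then show ?thesis
    using \<open>S \<noteq> {}\<close> by (simp add: sup_norm_def mdist_cfunspace_eq_mdist_funspace
        Met_TC.fdist_def dist_real_def)
qed


section \<open>Fractal functions and the fractal operator\<close>

definition scale_norm ::
    "(3 \<Rightarrow> real^2) \<Rightarrow> nat \<Rightarrow> (3 list \<Rightarrow> real^2 \<Rightarrow> real) \<Rightarrow> real" where
  "scale_norm p N \<alpha> = Max ((\<lambda>w. sup_norm (SG p) (\<alpha> w)) ` words N)"

definition fractal_function ::
    "(3 \<Rightarrow> real^2) \<Rightarrow> nat \<Rightarrow> (3 list \<Rightarrow> real^2 \<Rightarrow> real) \<Rightarrow> (real^2 \<Rightarrow> real) \<Rightarrow>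
       (real^2 \<Rightarrow> real) \<Rightarrow> real^2 \<Rightarrow> real" where
  "fractal_function p N \<alpha> b f = (THE g. g \<in> cspace (SG p) \<and>
     (\<forall>w\<in>words N. \<forall>t\<in>sg_word p w ` SG p.
        g t = f t + \<alpha> w (inv (sg_word p w) t) *
                      (g (inv (sg_word p w) t) - b (inv (sg_word p w) t))))"

definition fractal_operator ::
    "(3 \<Rightarrow> real^2) \<Rightarrow> nat \<Rightarrow> (3 list \<Rightarrow> real^2 \<Rightarrow> real) \<Rightarrow>
       ((real^2 \<Rightarrow> real) \<Rightarrow> (real^2 \<Rightarrow> real)) \<Rightarrow> (real^2 \<Rightarrow> real) \<Rightarrow> real^2 \<Rightarrow> real" where
  "fractal_operator p N \<alpha> L f = fractal_function p N \<alpha> (L f) f"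

end

theory Submission
  imports Defs
begin

text \<open>
  Write \<open>S\<close> for the gasket, \<open>a = \<parallel>\<alpha>\<parallel>\<close>, \<open>l = \<parallel>L\<parallel>\<close>. Say that \<open>f\<close> and \<open>g\<close> are related if
  \<open>g(L\<^sub>w y) = f(L\<^sub>w y) + \<alpha>\<^sub>w(y) (g(y) - (L f)(y))\<close> for all words \<open>w\<close> of length \<open>N\<close> and all \<open>y \<in> S\<close>;
  for \<open>f\<close> given, this is the equation that defines \<open>g = f\<^sup>\<alpha>\<close>. The relation is linear, and it is
  almost symmetric in its two arguments: it can be solved for \<open>g\<close> when \<open>f\<close> is given, and just as well
  for \<open>f\<close> when \<open>g\<close> is given. In both cases the unknown \<open>q\<close> satisfies
  \<open>q(L\<^sub>w y) = k(L\<^sub>w y) + \<alpha>\<^sub>w(y) (D q)(y)\<close>, where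
    \<^item> \<open>k = f\<close> and \<open>D q = q - L f\<close>, which has Lipschitz constant \<open>1\<close>, if \<open>q = g\<close>;
    \<^item> \<open>k = g\<close> and \<open>D q = L q - g\<close>, which has Lipschitz constant \<open>l\<close>, if \<open>q = f\<close>.

  The right-hand side is a contraction in \<open>q\<close> because \<open>a < 1\<close> and \<open>a l < 1\<close>, respectively, and
  Banach's theorem gives a solution (lemma \<open>self_referential_solution\<close>). The point that needs care
  is that the right-hand side prescribes values cell by cell, and the cells \<open>L\<^sub>w(S)\<close> overlap.
  Two different cells of the same level meet only in points that are images of vertices in both of
  them (lemma \<open>distinct_cells_meet_at_vertices\<close>), so the prescriptions agree as soon as \<open>D q\<close>
  vanishes at the three vertices (lemma \<open>glue_cells\<close>). Since \<open>L\<close> preserves values at the vertices, this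
  is the case for every \<open>q\<close> that agrees with \<open>k\<close> there; these \<open>q\<close> form a closed set that the iteration
  preserves, as each vertex is a fixed point of a cell map.

  The equation also yields \<open>\<parallel>g\<parallel> \<le> \<parallel>f\<parallel> + a \<parallel>g - L f\<parallel>\<close> and \<open>\<parallel>f\<parallel> \<le> \<parallel>g\<parallel> + a \<parallel>g - L f\<parallel>\<close>, where
  \<open>\<parallel>g - L f\<parallel> \<le> \<parallel>g\<parallel> + l \<parallel>f\<parallel>\<close>. Hence each of \<open>\<parallel>f\<parallel>\<close>, \<open>\<parallel>g\<parallel>\<close> is bounded by a multiple of the other.
  By linearity these two bounds contain the uniqueness of both solutions as well, and a linear
  relation that is total, onto and bounded in both directions is the graph of a topological
  isomorphism (lemma \<open>topological_isomorphism_linear_relation\<close>).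
\<close>

section \<open>Continuous functions on a compact set\<close>

lemma cspace_restrict:
  "continuous_on S f \<Longrightarrow> (\<lambda>t\<in>S. f t) \<in> cspace S"
  by (auto simp: cspace_def cong: continuous_on_cong)

lemma cspace_continuous: "f \<in> cspace S \<Longrightarrow> continuous_on S f"
  by (simp add: cspace_def)

lemma cspace_eqI:
  "f \<in> cspace S \<Longrightarrow> g \<in> cspace S \<Longrightarrow> (\<And>t. t \<in> S \<Longrightarrow> f t = g t) \<Longrightarrow> f = g"
  unfolding cspace_def by (blast intro: extensionalityI)

lemma cspace_add: "f \<in> cspace S \<Longrightarrow> g \<in> cspace S \<Longrightarrow> (\<lambda>t\<in>S. f t + g t) \<in> cspace S"
  by (intro cspace_restrict continuous_intros cspace_continuous)

lemma cspace_diff: "f \<in> cspace S \<Longrightarrow> g \<in> cspace S \<Longrightarrow> (\<lambda>t\<in>S. f t - g t) \<in> cspace S"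
  by (intro cspace_restrict continuous_intros cspace_continuous)

lemma cspace_scale: "f \<in> cspace S \<Longrightarrow> (\<lambda>t\<in>S. c * f t) \<in> cspace S"
  by (intro cspace_restrict continuous_intros cspace_continuous)

lemma abs_le_sup_norm:
  assumes "compact S" "f \<in> cspace S" "t \<in> S"
  shows "\<bar>f t\<bar> \<le> sup_norm S f"
proof -
  have "compact ((\<lambda>t. \<bar>f t\<bar>) ` S)"
    using assms by (intro compact_continuous_image continuous_intros cspace_continuous)
  then have "bdd_above ((\<lambda>t. \<bar>f t\<bar>) ` S)"
    by (intro bounded_imp_bdd_above compact_imp_bounded)
  then show ?thesis
    unfolding sup_norm_def using assms by (intro cSUP_upper)
qed

lemma sup_norm_leI:
  "S \<noteq> {} \<Longrightarrow> (\<And>t. t \<in> S \<Longrightarrow> \<bar>f t\<bar> \<le> B) \<Longrightarrow> sup_norm S f \<le> B"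
  unfolding sup_norm_def by (intro cSUP_least)

lemma sup_norm_nonneg:
  "compact S \<Longrightarrow> S \<noteq> {} \<Longrightarrow> f \<in> cspace S \<Longrightarrow> 0 \<le> sup_norm S f"
  using abs_le_sup_norm by (metis abs_ge_zero all_not_in_conv order_trans)

lemma sup_norm_diff_le:
  assumes "compact S" "S \<noteq> {}" "f \<in> cspace S" "g \<in> cspace S"
  shows "sup_norm S (\<lambda>t\<in>S. f t - g t) \<le> sup_norm S f + sup_norm S g"
proof (rule sup_norm_leI[OF assms(2)])
  fix t assume "t \<in> S"
  with abs_le_sup_norm[OF assms(1,3)] abs_le_sup_norm[OF assms(1,4)]
  show "\<bar>(\<lambda>t\<in>S. f t - g t) t\<bar> \<le> sup_norm S f + sup_norm S g"
    by fastforce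
qed

lemma sup_norm_eq_0D:
  assumes "compact S" "f \<in> cspace S" "sup_norm S f \<le> 0" "t \<in> S"
  shows "f t = 0"
  using abs_le_sup_norm[OF assms(1,2,4)] assms(3) by linarith

lemma sup_norm_le_op_norm:
  assumes S: "compact S" "S \<noteq> {}" and L: "bounded_linear_cspace S L" and f: "f \<in> cspace S"
  shows "sup_norm S (L f) \<le> op_norm S L * sup_norm S f"
proof -
  obtain K where K: "\<And>g. g \<in> cspace S \<Longrightarrow> sup_norm S (L g) \<le> K * sup_norm S g"
    using L by (auto simp: bounded_linear_cspace_def)
  have quot: "sup_norm S (L g) / sup_norm S g \<le> max K 0" if "g \<in> cspace S" for g
  proof (cases "sup_norm S g = 0")
    case False
    then have "sup_norm S g > 0"
      using sup_norm_nonneg[OF S that] by simp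
    then have "sup_norm S (L g) / sup_norm S g \<le> K"
      using K[OF that] by (simp add: divide_simps)
    then show ?thesis by simp
  qed simp
  have le: "sup_norm S (L f) / sup_norm S f \<le> op_norm S L"
    unfolding op_norm_def using quot f by (intro cSUP_upper bdd_aboveI2)
  show ?thesis
  proof (cases "sup_norm S f = 0")
    case True
    then show ?thesis using K[OF f] by simp
  next
    case False
    then have "sup_norm S f > 0"
      using sup_norm_nonneg[OF S f] by simp
    then show ?thesis
      using le by (simp add: divide_simps)
  qed
qed

text \<open>The sign is read off from one function of positive norm; the constant \<open>1\<close> serves.\<close>

lemma op_norm_nonneg:
  assumes S: "compact S" "S \<noteq> {}" and L: "bounded_linear_cspace S L"
  shows "0 \<le> op_norm S L"
proof -
  let ?u = "\<lambda>t\<in>S. 1::real"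
  have u: "?u \<in> cspace S"
    by (intro cspace_restrict continuous_intros)
  obtain t where "t \<in> S" using S by blast
  then have pos: "1 \<le> sup_norm S ?u"
    using abs_le_sup_norm[OF S(1) u] by fastforce
  have "L ?u \<in> cspace S"
    using L u by (auto simp: bounded_linear_cspace_def linear_cspace_def)
  then have "0 \<le> op_norm S L * sup_norm S ?u"
    using sup_norm_nonneg[OF S] sup_norm_le_op_norm[OF S L u] by (meson order_trans)
  then show ?thesis
    using pos by (simp add: zero_le_mult_iff)
qed

lemma bounded_linear_cspace_diff:
  assumes L: "bounded_linear_cspace S L" and f: "f \<in> cspace S" and g: "g \<in> cspace S"
    and t: "t \<in> S"
  shows "L f t - L g t = L (\<lambda>t\<in>S. f t - g t) t"
proof -
  have lin: "linear_cspace S L"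
    using L by (simp add: bounded_linear_cspace_def)
  let ?h = "\<lambda>t\<in>S. (-1) * g t"
  have h: "?h \<in> cspace S" by (rule cspace_scale[OF g])
  have eq: "(\<lambda>t\<in>S. f t - g t) = (\<lambda>t\<in>S. f t + ?h t)"
    by (auto simp: restrict_def)
  have "L (\<lambda>t\<in>S. f t - g t) = (\<lambda>t\<in>S. L f t + L ?h t)"
    unfolding eq using lin f h unfolding linear_cspace_def by blast
  moreover have "L ?h = (\<lambda>t\<in>S. (-1) * L g t)"
    using lin g unfolding linear_cspace_def by blast
  ultimately show ?thesis
    using t by simp
qed

text \<open>Banach's theorem on the set of continuous functions with prescribed values on \<open>V\<close>. This set is
  closed under uniform limits, hence complete.\<close>

lemma contraction_fixed_point_cspace:
  fixes k :: "'a::topological_space \<Rightarrow> real" and S V :: "'a set"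
  defines "X \<equiv> {h \<in> cspace S. \<forall>t\<in>V. h t = k t}"
  assumes S: "compact S" "S \<noteq> {}" and V: "V \<subseteq> S" and k: "k \<in> cspace S"
    and \<Phi>: "\<And>g. g \<in> X \<Longrightarrow> \<Phi> g \<in> X"
    and c: "c < 1"
    and contr: "\<And>g h. g \<in> X \<Longrightarrow> h \<in> X \<Longrightarrow>
      sup_norm S (\<lambda>t\<in>S. \<Phi> g t - \<Phi> h t) \<le> c * sup_norm S (\<lambda>t\<in>S. g t - h t)"
  obtains h where "h \<in> X" "\<Phi> h = h"
proof -
  let ?m = "cfunspace (top_of_set S) (euclidean_metric :: real metric)"
  have eqC: "mspace ?m = cspace S"
    by (simp only: cspace_eq_cfunspace[OF S(1)])
  have dist: "mdist ?m g h = sup_norm S (\<lambda>t\<in>S. g t - h t)" if "g \<in> cspace S" "h \<in> cspace S" for g h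
    using sup_norm_diff_eq_mdist[OF S that] by simp
  interpret M: Metric_space "cspace S" "mdist ?m"
    using Metric_space_mspace_mdist[of ?m] by (simp only: eqC)
  interpret X: Submetric "cspace S" "mdist ?m" "X"
    by unfold_locales (auto simp: X_def)
  have "mcomplete_of ?m"
    using Met_TC.mcomplete_cfunspace[of "top_of_set S", where ?'a = real]
    by (simp add: mcomplete_iff_complete complete_UNIV Met_TC.Self_def euclidean_metric_def[symmetric])
  then have complete: "M.mcomplete"
    by (simp only: mcomplete_of_def eqC)
  have "X.sub.mcomplete"
  proof (rule X.sequentially_closedin_mcomplete_imp_mcomplete[OF complete])
    fix \<sigma> l assume \<sigma>: "range \<sigma> \<subseteq> X \<and> limitin M.mtopology \<sigma> l sequentially"
    then have l: "l \<in> cspace S"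
      using M.limitin_mspace by blast
    have "l t = k t" if t: "t \<in> V" for t
    proof -
      have "\<bar>k t - l t\<bar> < e" if e: "e > 0" for e
      proof -
        obtain n where n: "mdist ?m (\<sigma> n) l < e"
          using \<sigma> e by (force simp: M.limit_metric_sequentially)
        have \<sigma>n: "\<sigma> n \<in> cspace S" "\<sigma> n t = k t"
          using \<sigma> t by (auto simp: X_def)
        have "\<bar>\<sigma> n t - l t\<bar> \<le> mdist ?m (\<sigma> n) l"
          using abs_le_sup_norm[OF S(1) cspace_diff[OF \<sigma>n(1) l], of t] t V dist[OF \<sigma>n(1) l] by auto
        then show ?thesis
          using n \<sigma>n(2) by simp
      qed
      then show ?thesis
        by (metis abs_le_zero_iff dense_ge eq_iff_diff_eq_0 less_imp_le)
    qed
    then show "l \<in> X"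
      using l by (simp add: X_def)
  qed
  then show thesis
  proof (rule X.sub.Banach_fixedpoint_thm)
    show "X \<noteq> {}" using k by (auto simp: X_def)
    show "\<Phi> \<in> X \<rightarrow> X" using \<Phi> by blast
    show "c < 1" by (rule c)
    fix g h assume gh: "g \<in> X" "h \<in> X"
    then have "g \<in> cspace S" "h \<in> cspace S" "\<Phi> g \<in> cspace S" "\<Phi> h \<in> cspace S"
      using \<Phi> by (auto simp: X_def)
    then show "mdist ?m (\<Phi> g) (\<Phi> h) \<le> c * mdist ?m g h"
      using contr[OF gh] by (simp add: dist)
  qed (use that in blast)
qed

text \<open>For a linear relation, the bound \<open>\<parallel>g\<parallel> \<le> K \<parallel>f\<parallel>\<close> applied to the difference of two related pairs
  with the same \<open>f\<close> forces the two \<open>g\<close> to be equal; the other bound gives injectivity in the same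
  way. The inverse operator is the converse relation, to which the same reasoning applies.\<close>

lemma topological_isomorphism_linear_relation:
  fixes R :: "('a::topological_space \<Rightarrow> real) \<Rightarrow> ('a \<Rightarrow> real) \<Rightarrow> bool"
  assumes S: "compact S" "S \<noteq> {}"
    and carrier: "\<And>f g. R f g \<Longrightarrow> f \<in> cspace S \<and> g \<in> cspace S"
    and add: "\<And>f f' g g'. R f g \<Longrightarrow> R f' g' \<Longrightarrow> R (\<lambda>t\<in>S. f t + f' t) (\<lambda>t\<in>S. g t + g' t)"
    and scale: "\<And>c f g. R f g \<Longrightarrow> R (\<lambda>t\<in>S. c * f t) (\<lambda>t\<in>S. c * g t)"
    and total: "\<And>f. f \<in> cspace S \<Longrightarrow> \<exists>g. R f g"
    and onto: "\<And>g. g \<in> cspace S \<Longrightarrow> \<exists>f. R f g"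
    and bound: "\<And>f g. R f g \<Longrightarrow> sup_norm S g \<le> K * sup_norm S f"
    and bound': "\<And>f g. R f g \<Longrightarrow> sup_norm S f \<le> K' * sup_norm S g"
    and T: "\<And>f. f \<in> cspace S \<Longrightarrow> T f = (THE g. R f g)"
  shows "topological_isomorphism_cspace S T"
proof -
  have diff: "R (\<lambda>t\<in>S. f t - f' t) (\<lambda>t\<in>S. g t - g' t)" if "R f g" "R f' g'" for f f' g g'
  proof -
    have "(\<lambda>t\<in>S. f t - f' t) = (\<lambda>t\<in>S. f t + (\<lambda>t\<in>S. (-1) * f' t) t)"
      "(\<lambda>t\<in>S. g t - g' t) = (\<lambda>t\<in>S. g t + (\<lambda>t\<in>S. (-1) * g' t) t)"
      by (auto simp: restrict_def)
    then show ?thesis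
      using add[OF that(1) scale[OF that(2), of "-1"]] by simp
  qed
  have zero: "sup_norm S (\<lambda>t\<in>S. f t - f t) = 0" for f :: "'a \<Rightarrow> real"
    using S(2) by (simp add: sup_norm_def)
  have unique: "g = g'" if "R f g" "R f g'" for f g g'
  proof (rule cspace_eqI)
    show "g \<in> cspace S" "g' \<in> cspace S"
      using that carrier by blast+
    fix t assume "t \<in> S"
    then show "g t = g' t"
      using sup_norm_eq_0D[OF S(1), of "\<lambda>t\<in>S. g t - g' t" t] carrier[OF diff[OF that]]
        bound[OF diff[OF that], unfolded zero] by simp
  qed
  have unique': "f = f'" if "R f g" "R f' g" for f f' g
  proof (rule cspace_eqI)
    show "f \<in> cspace S" "f' \<in> cspace S"
      using that carrier by blast+
    fix t assume "t \<in> S"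
    then show "f t = f' t"
      using sup_norm_eq_0D[OF S(1), of "\<lambda>t\<in>S. f t - f' t" t] carrier[OF diff[OF that]]
        bound'[OF diff[OF that], unfolded zero] by simp
  qed
  have RT: "R f (T f)" if "f \<in> cspace S" for f
    unfolding T[OF that] using total[OF that] unique by (metis theI)
  have T_eq: "T f = g" if "R f g" for f g
    using RT unique that carrier by blast
  have bij: "bij_betw T (cspace S) (cspace S)"
  proof (rule bij_betwI')
    show "(T f = T f') = (f = f')" if "f \<in> cspace S" "f' \<in> cspace S" for f f'
      using RT[OF that(1)] RT[OF that(2)] unique' by metis
    show "T f \<in> cspace S" if "f \<in> cspace S" for f
      using RT[OF that] carrier by blast
    show "\<exists>f\<in>cspace S. g = T f" if "g \<in> cspace S" for g
      using onto[OF that] T_eq carrier by metis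
  qed
  define T' where "T' = inv_into (cspace S) T"
  have RT': "R (T' g) g" if "g \<in> cspace S" for g
    using RT[of "T' g"] that bij unfolding T'_def
    by (metis bij_betw_imp_surj_on f_inv_into_f inv_into_into)
  have T'_eq: "T' g = f" if "R f g" for f g
    using RT' unique' that carrier by blast
  have "linear_cspace S T"
    unfolding linear_cspace_def using RT carrier by (blast intro: T_eq add scale)
  moreover have "linear_cspace S T'"
    unfolding linear_cspace_def using RT' carrier by (blast intro: T'_eq add scale)
  ultimately show ?thesis
    unfolding topological_isomorphism_cspace_def bounded_linear_cspace_def T'_def[symmetric]
    using bij RT RT' bound bound' by blast
qed

section \<open>The Sierpinski gasket and its cells\<close>

lemma dist_sg_map: "dist (sg_map p i t) (sg_map p i u) = dist t u / 2"
proof -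
  have "sg_map p i t - sg_map p i u = (1/2) *\<^sub>R (t - u)"
    by (simp add: sg_map_def algebra_simps)
  then show ?thesis by (simp add: dist_norm)
qed

lemma inj_sg_map: "inj (sg_map p i)"
  by (rule injI) (simp add: sg_map_def)

lemma sg_map_vertex: "sg_map p i (p i) = p i"
  by (simp add: sg_map_def scaleR_2[symmetric])

lemma closure_sg_map: "closure (sg_map p i ` U) = sg_map p i ` closure U"
proof -
  have "sg_map p i ` W = (*\<^sub>R) (1/2) ` (+) (p i) ` W" for W
    by (auto simp: sg_map_def image_image add.commute)
  then show ?thesis
    by (simp only: closure_scaleR[symmetric] closure_translation)
qed

text \<open>The maps halve distances. Thus the largest distance of a point of \<open>K\<close> to \<open>K'\<close>, attained at \<open>m\<close>, is
  at most half of itself: \<open>m\<close> is the image of a point \<open>s\<close> of \<open>K\<close>, and the image of the point of \<open>K'\<close>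
  nearest to \<open>s\<close> is again in \<open>K'\<close>.\<close>

lemma invariant_set_unique_subset:
  assumes K: "compact K" "K \<noteq> {}" "K = (\<Union>i. sg_map p i ` K)"
    and K': "compact K'" "K' \<noteq> {}" "K' = (\<Union>i. sg_map p i ` K')"
  shows "K \<subseteq> K'"
proof -
  have "continuous_on K (\<lambda>t. infdist t K')"
    by (intro continuous_intros)
  then obtain m where m: "m \<in> K" "\<And>t. t \<in> K \<Longrightarrow> infdist t K' \<le> infdist m K'"
    using continuous_attains_sup[OF K(1,2)] by blast
  have "m \<in> (\<Union>i. sg_map p i ` K)"
    by (rule subst[OF K(3), of "\<lambda>X. m \<in> X"]) (rule m(1))
  then obtain i s where s: "s \<in> K" "m = sg_map p i s"
    by blast
  obtain u where u: "u \<in> K'" "infdist s K' = dist s u"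
    using infdist_attains_inf[OF compact_imp_closed[OF K'(1)] K'(2)] by metis
  have "sg_map p i u \<in> K'"
    by (subst K'(3)) (use u(1) in blast)
  then have "infdist m K' \<le> dist s u / 2"
    using infdist_le s(2) dist_sg_map by metis
  also have "\<dots> \<le> infdist m K' / 2"
    using m(2)[OF s(1)] u(2) by simp
  finally have "infdist m K' = 0"
    using infdist_nonneg[of m K'] by linarith
  then have "infdist t K' = 0" if "t \<in> K" for t
    using m(2)[OF that] infdist_nonneg[of t K'] by simp
  then show ?thesis
    using in_closed_iff_infdist_zero[OF compact_imp_closed[OF K'(1)] K'(2)] by blast
qed

text \<open>The invariant set is obtained as the closure of the orbit \<open>U\<close> of the vertices under the three
  maps. Each vertex is a fixed point of one of the maps, so \<open>U\<close> is itself invariant, and this passes to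
  the closure because the union is finite. The triangle contains the vertices and is mapped into
  itself, hence contains \<open>U\<close>, which gives compactness of the closure.\<close>

lemma SG_properties:
  shows compact_SG: "compact (SG p)" and SG_invariant: "SG p = (\<Union>i. sg_map p i ` SG p)"
    and vertices_SG: "range p \<subseteq> SG p" and SG_subset_triangle: "SG p \<subseteq> convex hull range p"
proof -
  define U where "U = lfp (\<lambda>X. range p \<union> (\<Union>i. sg_map p i ` X))"
  have mono: "mono (\<lambda>X. range p \<union> (\<Union>i. sg_map p i ` X))"
    by (rule monoI) blast
  have unfold: "U = range p \<union> (\<Union>i. sg_map p i ` U)"
    unfolding U_def by (rule lfp_unfold[OF mono])
  have vertex: "range p \<subseteq> U"
    by (subst unfold) (rule Un_upper1)
  have "p i \<in> (\<Union>i. sg_map p i ` U)" for i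
  proof
    have "p i \<in> U" using vertex by blast
    then show "p i \<in> sg_map p i ` U"
      by (rule rev_image_eqI) (simp add: sg_map_vertex)
  qed simp
  then have "range p \<subseteq> (\<Union>i. sg_map p i ` U)"
    by blast
  then have U: "U = (\<Union>i. sg_map p i ` U)"
    using unfold by (simp only: Un_absorb1)
  have hull: "U \<subseteq> convex hull range p"
    unfolding U_def
  proof (rule lfp_lowerbound)
    have "sg_map p i t \<in> convex hull range p" if "t \<in> convex hull range p" for i t
    proof -
      have "(1/2) *\<^sub>R t + (1/2) *\<^sub>R p i \<in> convex hull range p"
        using that by (intro convexD[OF convex_convex_hull]) (auto intro: hull_inc)
      then show ?thesis by (simp add: sg_map_def algebra_simps)
    qed
    then show "range p \<union> (\<Union>i. sg_map p i ` (convex hull range p)) \<subseteq> convex hull range p"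
      using hull_subset[of "range p" convex] by blast
  qed
  have compact_hull: "compact (convex hull range p)"
    by (intro finite_imp_compact_convex_hull finite_imageI finite)
  have invariant: "closure U = (\<Union>i. sg_map p i ` closure U)"
  proof -
    have "closure U = closure (\<Union>i. sg_map p i ` U)" by (rule arg_cong[OF U])
    also have "\<dots> = (\<Union>i. sg_map p i ` closure U)"
      by (simp add: UNIV_3 closure_sg_map)
    finally show ?thesis .
  qed
  have compact: "compact (closure U)"
    using hull compact_hull by (meson bounded_subset compact_closure compact_imp_bounded)
  have vert: "range p \<subseteq> closure U"
    using vertex closure_subset by (rule order_trans)
  then have ne: "closure U \<noteq> {}"
    by (metis UNIV_not_empty image_is_empty subset_empty)
  have SG: "SG p = closure U"
    unfolding SG_def
  proof (rule the_equality)
    show "compact (closure U) \<and> closure U \<noteq> {} \<and> closure U = (\<Union>i. sg_map p i ` closure U)"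
      by (intro conjI compact ne invariant)
    fix K assume K: "compact K \<and> K \<noteq> {} \<and> K = (\<Union>i. sg_map p i ` K)"
    show "K = closure U"
    proof
      note K = K[THEN conjunct1] K[THEN conjunct2, THEN conjunct1] K[THEN conjunct2, THEN conjunct2]
      show "K \<subseteq> closure U"
        by (rule invariant_set_unique_subset[OF K compact ne invariant])
      show "closure U \<subseteq> K"
        by (rule invariant_set_unique_subset[OF compact ne invariant K])
    qed
  qed
  show "compact (SG p)" "SG p = (\<Union>i. sg_map p i ` SG p)" "range p \<subseteq> SG p"
    unfolding SG by (rule compact invariant vert)+
  show "SG p \<subseteq> convex hull range p"
    unfolding SG by (intro closure_minimal hull compact_imp_closed compact_hull)
qed

lemma SG_nonempty: "SG p \<noteq> {}"
  using vertices_SG[of p] by (metis UNIV_not_empty image_is_empty subset_empty)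

lemma sg_word_Nil [simp]: "sg_word p [] = id"
  by (simp add: sg_word_def)

lemma sg_word_Cons [simp]: "sg_word p (i # w) = sg_map p i \<circ> sg_word p w"
  by (simp add: sg_word_def)

lemma inj_sg_word: "inj (sg_word p w)"
proof (induction w)
  case (Cons i w)
  then show ?case
    by (simp only: sg_word_Cons inj_compose[OF inj_sg_map])
qed simp

lemma inv_sg_word: "inv (sg_word p w) (sg_word p w y) = y"
  by (rule inv_f_f[OF inj_sg_word])

lemma continuous_on_sg_word: "continuous_on A (sg_word p w)"
proof (induction w)
  case (Cons i w)
  have "continuous_on B (sg_map p i)" for B
    unfolding sg_map_def by (intro continuous_intros)
  then show ?case
    using Cons by (simp add: continuous_on_compose del: comp_apply)
qed (simp add: continuous_on_id id_def)

lemma sg_word_in_SG: "y \<in> SG p \<Longrightarrow> sg_word p w y \<in> SG p"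
  using SG_invariant[of p] by (induction w) auto

lemma SG_cell_cover:
  assumes "t \<in> SG p"
  shows "\<exists>w\<in>words N. \<exists>y\<in>SG p. t = sg_word p w y"
  using assms
proof (induction N arbitrary: t)
  case 0
  then show ?case by (auto simp: words_def)
next
  case (Suc N)
  obtain i u where u: "u \<in> SG p" "t = sg_map p i u"
    using Suc.prems SG_invariant[of p] by blast
  obtain w y where "w \<in> words N" "y \<in> SG p" "u = sg_word p w y"
    using Suc.IH[OF u(1)] by blast
  then show ?case
    using u(2) by (intro bexI[of _ "i # w"] bexI[of _ y]) (auto simp: words_def)
qed

lemma finite_words: "finite (words N)"
  using finite_lists_length_eq[of "UNIV :: 3 set" N] by (simp add: words_def)

lemma replicate_words: "replicate N j \<in> words N"
  by (simp add: words_def)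

lemma sg_word_replicate: "sg_word p (replicate N j) (p j) = p j"
  by (induction N) (simp_all add: sg_map_vertex)

text \<open>The affine function \<open>\<phi>\<close> is the barycentric coordinate of the vertex \<open>p j\<close>. Each contraction averages
  with a vertex, so it acts on this coordinate by \<open>x \<mapsto> x / 2\<close> or \<open>x \<mapsto> (x + 1) / 2\<close>.
  This turns questions about the position of cells into arithmetic in \<open>[0, 1]\<close>.\<close>

lemma triangle_coordinate:
  assumes "equilateral p"
  obtains \<phi> :: "real^2 \<Rightarrow> real" where
    "\<And>i t. \<phi> (sg_map p i t) = (\<phi> t + of_bool (i = j)) / 2"
    "\<And>t. t \<in> convex hull range p \<Longrightarrow> 0 \<le> \<phi> t"
    "\<And>t. t \<in> convex hull range p \<Longrightarrow> \<phi> t \<le> 1"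
    "\<And>t. t \<in> convex hull range p \<Longrightarrow> \<phi> t = 1 \<Longrightarrow> t = p j"
proof -
  obtain s where s: "s > 0" "\<And>i k. i \<noteq> k \<Longrightarrow> dist (p i) (p k) = s"
    using assms by (auto simp: equilateral_def)
  have sq: "p i \<bullet> p i + p k \<bullet> p k - 2 * (p i \<bullet> p k) = s\<^sup>2" if "i \<noteq> k" for i k
  proof -
    have "(p i - p k) \<bullet> (p i - p k) = s\<^sup>2"
      using s(2)[OF that] by (simp add: dist_norm dot_square_norm)
    then show ?thesis by (simp add: inner_diff inner_commute)
  qed
  \<comment> \<open>The normal of the opposite side: by the cosine rule, the sum has inner product
    \<open>- (s\<^sup>2 + s\<^sup>2 / 2)\<close> with each edge that leaves \<open>p j\<close>.\<close>
  define n where "n = (2 / (3 * s\<^sup>2)) *\<^sub>R (\<Sum>k\<in>UNIV. p j - p k)"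
  define \<phi> where "\<phi> t = 1 + (t - p j) \<bullet> n" for t
  have vertex: "\<phi> (p i) = of_bool (i = j)" for i
  proof (cases "i = j")
    case False
    have "(p i - p j) \<bullet> (p j - p k) = (if k = j then 0 else if k = i then - s\<^sup>2 else - (s\<^sup>2 / 2))" for k
      using sq[OF False] sq[of j k] sq[of i k] by (auto simp: inner_diff inner_commute)
    then have "(p i - p j) \<bullet> (\<Sum>k\<in>UNIV. p j - p k)
        = (\<Sum>k\<in>UNIV. if k = j then 0 else if k = i then - s\<^sup>2 else - (s\<^sup>2 / 2))"
      by (simp only: inner_sum_right)
    also have "\<dots> = - (3 * s\<^sup>2 / 2)"
      using False exhaust_3[of i] exhaust_3[of j] by (auto simp: sum_3)
    finally show ?thesis
      using s(1) False by (simp add: \<phi>_def n_def)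
  qed (simp add: \<phi>_def)
  have inj: "inj p"
    using s by (metis dist_self injI less_irrefl)
  have combination: "\<exists>c. (\<forall>i. 0 \<le> c i) \<and> sum c UNIV = 1 \<and> (\<Sum>i\<in>UNIV. c i *\<^sub>R p i) = t \<and> \<phi> t = c j"
    if "t \<in> convex hull range p" for t
  proof -
    obtain u where u: "\<forall>x\<in>range p. 0 \<le> u x" "sum u (range p) = 1" "(\<Sum>x\<in>range p. u x *\<^sub>R x) = t"
      using \<open>t \<in> convex hull range p\<close> by (auto simp: convex_hull_finite)
    define c where "c = u \<circ> p"
    have c: "\<forall>i. 0 \<le> c i" "sum c UNIV = 1" "(\<Sum>i\<in>UNIV. c i *\<^sub>R p i) = t"
      using u inj by (simp_all add: c_def sum.reindex)
    have "\<phi> t = (\<Sum>i\<in>UNIV. c i) + ((\<Sum>i\<in>UNIV. c i *\<^sub>R p i) - (\<Sum>i\<in>UNIV. c i) *\<^sub>R p j) \<bullet> n"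
      using c by (simp add: \<phi>_def)
    also have "\<dots> = (\<Sum>i\<in>UNIV. c i * \<phi> (p i))"
      by (simp add: \<phi>_def inner_diff_left inner_sum_left scaleR_sum_left
          sum_subtractf sum.distrib algebra_simps sum_distrib_left)
    also have "\<dots> = c j"
      by (simp add: vertex)
    finally show ?thesis using c by blast
  qed
  show thesis
  proof
    show "\<phi> (sg_map p i t) = (\<phi> t + of_bool (i = j)) / 2" for i t
    proof -
      have "\<phi> (sg_map p i t) = (\<phi> t + \<phi> (p i)) / 2"
        by (simp add: \<phi>_def sg_map_def inner_diff_left inner_add_left field_simps)
      then show ?thesis by (simp add: vertex)
    qed
    fix t assume t: "t \<in> convex hull range p"
    obtain c where c: "\<And>i. 0 \<le> c i" "sum c UNIV = 1" "(\<Sum>i\<in>UNIV. c i *\<^sub>R p i) = t" "\<phi> t = c j"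
      using combination[OF t] by blast
    have split: "c j + sum c (UNIV - {j}) = 1"
      using c(2) by (simp add: sum.remove[of UNIV j])
    have nonneg: "0 \<le> sum c (UNIV - {j})"
      by (intro sum_nonneg c(1))
    show "0 \<le> \<phi> t" "\<phi> t \<le> 1"
      using c split nonneg by auto
    assume "\<phi> t = 1"
    then have "sum c (UNIV - {j}) = 0"
      using split c(4) by simp
    then have "c i = 0" if "i \<noteq> j" for i
      using that c(1) by (simp add: sum_nonneg_eq_0_iff)
    then have "(\<Sum>i\<in>UNIV. c i *\<^sub>R p i) = (\<Sum>i\<in>UNIV. if i = j then p j else 0)"
      using c(4) \<open>\<phi> t = 1\<close> by (intro sum.cong) auto
    then show "t = p j"
      using c(3) by simp
  qed
qed

text \<open>The vertex \<open>p j\<close> is the only point of the triangle where its coordinate reaches the maximum \<open>1\<close>, and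
  a contraction can only produce the value \<open>1\<close> from a value that is at least \<open>1\<close>.\<close>

lemma sg_word_eq_vertexD:
  assumes p: "equilateral p" and y: "y \<in> SG p" and eq: "sg_word p w y = p j"
  shows "y = p j"
  using eq
proof (induction w)
  case (Cons i w)
  obtain \<phi> :: "real^2 \<Rightarrow> real" where \<phi>:
    "\<And>i t. \<phi> (sg_map p i t) = (\<phi> t + of_bool (i = j)) / 2"
    "\<And>t. t \<in> convex hull range p \<Longrightarrow> \<phi> t \<le> 1"
    "\<And>t. t \<in> convex hull range p \<Longrightarrow> \<phi> t = 1 \<Longrightarrow> t = p j"
    using triangle_coordinate[OF p] by metis
  let ?u = "sg_word p w y"
  have u: "?u \<in> convex hull range p"
    using sg_word_in_SG[OF y] SG_subset_triangle by blast
  have "\<phi> (p j) = 1"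
    using \<phi>(1)[of j "p j"] by (simp add: sg_map_vertex)
  then have "1 \<le> \<phi> ?u"
    using \<phi>(1)[of i ?u] Cons.prems by (cases "i = j") auto
  then show ?case
    using \<phi>(2,3)[OF u] Cons.IH by simp
qed simp

text \<open>A common prefix of the words can be cancelled. If the first letters \<open>i\<close> and \<open>i'\<close> differ, look at the
  coordinate of \<open>p i'\<close>: the first cell lies where it is at most \<open>1/2\<close>, the second where it is at least
  \<open>1/2\<close>. Equality must hold, which makes the point that is mapped by the letter \<open>i\<close> the vertex \<open>p i'\<close>.\<close>

lemma distinct_cells_meet_at_vertices:
  assumes p: "equilateral p" and w: "length w = length w'" "w \<noteq> w'"
    and y: "y \<in> SG p" "y' \<in> SG p" and eq: "sg_word p w y = sg_word p w' y'"
  shows "y \<in> range p"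
  using w eq
proof (induction w w' rule: list_induct2)
  case (Cons i w i' w')
  let ?u = "sg_word p w y" and ?u' = "sg_word p w' y'"
  show ?case
  proof (cases "i = i'")
    case True
    then show ?thesis
      using Cons inj_sg_map[of p i] by (simp add: inj_eq)
  next
    case False
    obtain \<phi> :: "real^2 \<Rightarrow> real" where \<phi>:
      "\<And>i t. \<phi> (sg_map p i t) = (\<phi> t + of_bool (i = i')) / 2"
      "\<And>t. t \<in> convex hull range p \<Longrightarrow> 0 \<le> \<phi> t"
      "\<And>t. t \<in> convex hull range p \<Longrightarrow> \<phi> t \<le> 1"
      "\<And>t. t \<in> convex hull range p \<Longrightarrow> \<phi> t = 1 \<Longrightarrow> t = p i'"
      using triangle_coordinate[OF p] by metis
    have u: "?u \<in> convex hull range p" "?u' \<in> convex hull range p"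
      using sg_word_in_SG y SG_subset_triangle by blast+
    have "\<phi> ?u = \<phi> ?u' + 1"
      using \<phi>(1)[of i ?u] \<phi>(1)[of i' ?u'] Cons.prems False by simp
    then have "?u = p i'"
      using \<phi>(2)[OF u(2)] \<phi>(3,4)[OF u(1)] by simp
    then show ?thesis
      using sg_word_eq_vertexD[OF p y(1)] by blast
  qed
qed simp

section \<open>Self-referential equations on the gasket\<close>

text \<open>On the overlap of two cells, \<open>h\<close> is evaluated only at vertices; there it vanishes, and both
  prescriptions reduce to the value of \<open>k\<close>.\<close>

lemma glue_cells:
  assumes p: "equilateral p" and \<alpha>: "\<And>w. w \<in> words N \<Longrightarrow> \<alpha> w \<in> cspace (SG p)"
    and k: "k \<in> cspace (SG p)" and h: "h \<in> cspace (SG p)" and h0: "\<And>t. t \<in> range p \<Longrightarrow> h t = 0"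
  shows "\<exists>q\<in>cspace (SG p). \<forall>w\<in>words N. \<forall>y\<in>SG p.
    q (sg_word p w y) = k (sg_word p w y) + \<alpha> w y * h y"
proof -
  let ?S = "SG p" and ?cell = "\<lambda>w. sg_word p w ` SG p"
  let ?f = "\<lambda>w t. k t + \<alpha> w (inv (sg_word p w) t) * h (inv (sg_word p w) t)"
  have sub: "?cell w \<subseteq> ?S" for w
    using sg_word_in_SG by blast
  obtain q where q: "continuous_map (top_of_set ?S) euclidean q"
    "\<And>t w. \<lbrakk>w \<in> words N; t \<in> topspace (top_of_set ?S) \<inter> ?cell w\<rbrakk> \<Longrightarrow> q t = ?f w t"
  proof (rule pasting_lemma_exists_closed[of "words N" "top_of_set ?S" ?cell euclidean ?f])
    show "finite (words N)" by (rule finite_words)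
    show "topspace (top_of_set ?S) \<subseteq> \<Union> (?cell ` words N)"
      using SG_cell_cover by fastforce
    fix w assume w: "w \<in> words N"
    have "compact (?cell w)"
      using continuous_on_sg_word compact_SG by (rule compact_continuous_image)
    then show "closedin (top_of_set ?S) (?cell w)"
      using sub by (simp add: closed_subset compact_imp_closed)
    have inv: "continuous_on (?cell w) (inv (sg_word p w))"
      using continuous_on_sg_word compact_SG inv_sg_word by (intro continuous_on_inv) auto
    have "continuous_on (?cell w) (\<lambda>t. g (inv (sg_word p w) t))" if "g \<in> cspace ?S" for g
      by (rule continuous_on_compose2[OF cspace_continuous[OF that] inv]) (auto simp: inv_sg_word)
    then have "continuous_on (?cell w) (?f w)"
      using \<alpha>[OF w] h continuous_on_subset[OF cspace_continuous[OF k] sub[of w]]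
      by (intro continuous_intros) auto
    then show "continuous_map (subtopology (top_of_set ?S) (?cell w)) euclidean (?f w)"
      using sub[of w] by (simp add: subtopology_subtopology Int_absorb1)
  next
    fix w w' t assume w: "w \<in> words N" "w' \<in> words N"
      and t: "t \<in> topspace (top_of_set ?S) \<inter> ?cell w \<inter> ?cell w'"
    show "?f w t = ?f w' t"
    proof (cases "w = w'")
      case False
      obtain y y' where y: "y \<in> ?S" "t = sg_word p w y" and y': "y' \<in> ?S" "t = sg_word p w' y'"
        using t by auto
      have "y \<in> range p" "y' \<in> range p"
        using distinct_cells_meet_at_vertices[OF p, of w w' y y']
          distinct_cells_meet_at_vertices[OF p, of w' w y' y] False w y y'
        by (auto simp: words_def)
      then have "h (inv (sg_word p w) t) = 0" "h (inv (sg_word p w') t) = 0"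
        using h0 inv_sg_word y(2) y'(2) by metis+
      then show ?thesis by simp
    qed simp
  qed (use that in blast)
  show ?thesis
  proof (intro bexI[of _ "\<lambda>t\<in>?S. q t"] ballI)
    show "(\<lambda>t\<in>?S. q t) \<in> cspace ?S"
      using q(1) by (intro cspace_restrict) simp
    fix w y assume "w \<in> words N" "y \<in> ?S"
    then show "(\<lambda>t\<in>?S. q t) (sg_word p w y) = k (sg_word p w y) + \<alpha> w y * h y"
      using q(2)[of w "sg_word p w y"] by (simp add: sg_word_in_SG inv_sg_word)
  qed
qed

lemma scale_norm_bounds:
  assumes \<alpha>: "\<And>w. w \<in> words N \<Longrightarrow> \<alpha> w \<in> cspace (SG p)"
  shows "w \<in> words N \<Longrightarrow> y \<in> SG p \<Longrightarrow> \<bar>\<alpha> w y\<bar> \<le> scale_norm p N \<alpha>"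
    and "0 \<le> scale_norm p N \<alpha>"
proof -
  have le: "sup_norm (SG p) (\<alpha> w) \<le> scale_norm p N \<alpha>" if "w \<in> words N" for w
    unfolding scale_norm_def using that finite_words by (intro Max_ge) auto
  show "w \<in> words N \<Longrightarrow> y \<in> SG p \<Longrightarrow> \<bar>\<alpha> w y\<bar> \<le> scale_norm p N \<alpha>"
    using abs_le_sup_norm[OF compact_SG] \<alpha> le by (meson order_trans)
  show "0 \<le> scale_norm p N \<alpha>"
    using le[OF replicate_words[of N 0]]
      sup_norm_nonneg[OF compact_SG SG_nonempty \<alpha>[OF replicate_words[of N 0]]] by linarith
qed

text \<open>Each point lies in some cell, where \<open>\<alpha>\<^sub>w(y)\<close> multiplies \<open>h\<close> by at most \<open>\<parallel>\<alpha>\<parallel>\<close>. The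
  estimate serves both for the contraction property and, for solutions of the equation, for the
  boundedness of the fractal operator and of its inverse.\<close>

lemma self_referential_sup_norm_le:
  assumes \<alpha>: "\<And>w. w \<in> words N \<Longrightarrow> \<alpha> w \<in> cspace (SG p)"
    and k: "k \<in> cspace (SG p)" and h: "h \<in> cspace (SG p)"
    and q: "\<And>w y. w \<in> words N \<Longrightarrow> y \<in> SG p \<Longrightarrow>
      q (sg_word p w y) = k (sg_word p w y) + \<alpha> w y * h y"
  shows "sup_norm (SG p) q \<le> sup_norm (SG p) k + scale_norm p N \<alpha> * sup_norm (SG p) h"
proof (rule sup_norm_leI[OF SG_nonempty])
  fix t assume "t \<in> SG p"
  then obtain w y where w: "w \<in> words N" and y: "y \<in> SG p" and t: "t = sg_word p w y"
    using SG_cell_cover by metis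
  have "\<bar>q t\<bar> \<le> \<bar>k t\<bar> + \<bar>\<alpha> w y\<bar> * \<bar>h y\<bar>"
    using q[OF w y] t abs_triangle_ineq[of "k t" "\<alpha> w y * h y"] by (simp add: abs_mult)
  also have "\<dots> \<le> sup_norm (SG p) k + scale_norm p N \<alpha> * sup_norm (SG p) h"
    using \<open>t \<in> SG p\<close> w y k h
    by (intro add_mono mult_mono abs_le_sup_norm compact_SG scale_norm_bounds \<alpha>) auto
  finally show "\<bar>q t\<bar> \<le> sup_norm (SG p) k + scale_norm p N \<alpha> * sup_norm (SG p) h" .
qed

text \<open>Gluing gives a map \<open>\<Phi>\<close> that sends \<open>g\<close> to the function with the cell values
  \<open>k(L\<^sub>w y) + \<alpha>\<^sub>w(y) (D g)(y)\<close>, defined for those \<open>g\<close> that agree with \<open>k\<close> at the vertices. It preserves this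
  agreement, since the cell of the constant word \<open>j \<dots> j\<close> evaluates \<open>D g\<close> at \<open>p j\<close> to compute the value
  at \<open>p j\<close>. Fixed points of \<open>\<Phi>\<close> are the solutions.\<close>

lemma self_referential_solution:
  assumes p: "equilateral p" and \<alpha>: "\<And>w. w \<in> words N \<Longrightarrow> \<alpha> w \<in> cspace (SG p)"
    and k: "k \<in> cspace (SG p)"
    and D: "\<And>g. g \<in> cspace (SG p) \<Longrightarrow> D g \<in> cspace (SG p)"
    and D0: "\<And>g t. g \<in> cspace (SG p) \<Longrightarrow> (\<And>t. t \<in> range p \<Longrightarrow> g t = k t) \<Longrightarrow> t \<in> range p \<Longrightarrow> D g t = 0"
    and lip: "\<And>g h. g \<in> cspace (SG p) \<Longrightarrow> h \<in> cspace (SG p) \<Longrightarrow>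
      sup_norm (SG p) (\<lambda>t\<in>SG p. D g t - D h t) \<le> d * sup_norm (SG p) (\<lambda>t\<in>SG p. g t - h t)"
    and small: "scale_norm p N \<alpha> * d < 1"
  shows "\<exists>q\<in>cspace (SG p). \<forall>w\<in>words N. \<forall>y\<in>SG p.
    q (sg_word p w y) = k (sg_word p w y) + \<alpha> w y * D q y"
proof -
  let ?S = "SG p" and ?a = "scale_norm p N \<alpha>"
  let ?X = "{g \<in> cspace ?S. \<forall>t\<in>range p. g t = k t}"
  have "\<forall>g\<in>?X. \<exists>q\<in>cspace ?S. \<forall>w\<in>words N. \<forall>y\<in>?S.
      q (sg_word p w y) = k (sg_word p w y) + \<alpha> w y * D g y"
    using D D0 by (intro ballI glue_cells[OF p \<alpha> k]) auto
  then obtain \<Phi> where \<Phi>C: "\<And>g. g \<in> ?X \<Longrightarrow> \<Phi> g \<in> cspace ?S"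
    and \<Phi>: "\<And>g w y. g \<in> ?X \<Longrightarrow> w \<in> words N \<Longrightarrow> y \<in> ?S \<Longrightarrow>
      \<Phi> g (sg_word p w y) = k (sg_word p w y) + \<alpha> w y * D g y"
    by (metis (no_types, lifting) bchoice)
  obtain q where "q \<in> ?X" "\<Phi> q = q"
  proof (rule contraction_fixed_point_cspace[OF compact_SG SG_nonempty vertices_SG k, of \<Phi> "?a * d"])
    fix g assume g: "g \<in> ?X"
    have "\<Phi> g t = k t" if "t \<in> range p" for t
    proof -
      obtain j where t: "t = p j" using \<open>t \<in> range p\<close> by blast
      have "t \<in> ?S" using that vertices_SG by blast
      moreover have "D g t = 0"
        using g that by (intro D0) auto
      ultimately show ?thesis
        using \<Phi>[OF g replicate_words[of N j], of t] by (simp add: t sg_word_replicate)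
    qed
    then show "\<Phi> g \<in> ?X"
      using \<Phi>C[OF g] by simp
  next
    show "?a * d < 1" by (rule small)
  next
    fix g h assume g: "g \<in> ?X" and h: "h \<in> ?X"
    \<comment> \<open>The difference of two values of \<open>\<Phi>\<close> satisfies an equation of the same kind with \<open>k = 0\<close>.\<close>
    let ?z = "\<lambda>t\<in>?S. 0 :: real"
    have z: "?z \<in> cspace ?S" "sup_norm ?S ?z = 0"
      using SG_nonempty by (auto simp: sup_norm_def intro!: cspace_restrict continuous_intros)
    have "sup_norm ?S (\<lambda>t\<in>?S. \<Phi> g t - \<Phi> h t)
        \<le> sup_norm ?S ?z + ?a * sup_norm ?S (\<lambda>t\<in>?S. D g t - D h t)"
    proof (rule self_referential_sup_norm_le[OF \<alpha> z(1)])
      show "(\<lambda>t\<in>?S. D g t - D h t) \<in> cspace ?S"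
        using D g h by (intro cspace_diff) auto
      fix w y assume "w \<in> words N" "y \<in> ?S"
      then show "(\<lambda>t\<in>?S. \<Phi> g t - \<Phi> h t) (sg_word p w y)
          = ?z (sg_word p w y) + \<alpha> w y * (\<lambda>t\<in>?S. D g t - D h t) y"
        using \<Phi>[OF g] \<Phi>[OF h] by (simp add: sg_word_in_SG algebra_simps)
    qed
    also have "\<dots> \<le> ?a * (d * sup_norm ?S (\<lambda>t\<in>?S. g t - h t))"
      using lip[of g h] g h scale_norm_bounds(2)[OF \<alpha>] z(2) by (simp add: mult_left_mono)
    finally show "sup_norm ?S (\<lambda>t\<in>?S. \<Phi> g t - \<Phi> h t) \<le> ?a * d * sup_norm ?S (\<lambda>t\<in>?S. g t - h t)"
      by (simp add: mult.assoc)
  qed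
  then show ?thesis
    using \<Phi>[of q] by (intro bexI[of _ q]) auto
qed

section \<open>The fractal operator\<close>

theorem theorem3p4:
  fixes p :: "3 \<Rightarrow> real^2"
    and N :: nat
    and \<alpha> :: "3 list \<Rightarrow> real^2 \<Rightarrow> real"
    and L :: "(real^2 \<Rightarrow> real) \<Rightarrow> (real^2 \<Rightarrow> real)"
  assumes "equilateral p"
    and "N \<ge> 1"
    and "\<And>w. w \<in> words N \<Longrightarrow> \<alpha> w \<in> cspace (SG p)"
    and "\<And>w. w \<in> words N \<Longrightarrow> sup_norm (SG p) (\<alpha> w) < 1"
    and "bounded_linear_cspace (SG p) L"
    and "\<And>f t. f \<in> cspace (SG p) \<Longrightarrow> t \<in> range p \<Longrightarrow> L f t = f t"
    and "scale_norm p N \<alpha> < inverse (op_norm (SG p) L)"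
  shows "topological_isomorphism_cspace (SG p) (fractal_operator p N \<alpha> L)"
proof -
  let ?S = "SG p" and ?a = "scale_norm p N \<alpha>" and ?l = "op_norm (SG p) L"
  note p = assms(1) and \<alpha> = assms(3) and L = assms(5) and L0 = assms(6)
  note S = compact_SG[of p] SG_nonempty[of p]
  have vS: "t \<in> ?S" if "t \<in> range p" for t
    using that vertices_SG by blast
  have LC: "L f \<in> cspace ?S" if "f \<in> cspace ?S" for f
    using L that by (auto simp: bounded_linear_cspace_def linear_cspace_def)
  have L_add: "L (\<lambda>t\<in>?S. f t + g t) = (\<lambda>t\<in>?S. L f t + L g t)"
    if "f \<in> cspace ?S" "g \<in> cspace ?S" for f g
    using L that by (simp add: bounded_linear_cspace_def linear_cspace_def)
  have L_scale: "L (\<lambda>t\<in>?S. c * f t) = (\<lambda>t\<in>?S. c * L f t)" if "f \<in> cspace ?S" for f c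
    using L that by (simp add: bounded_linear_cspace_def linear_cspace_def)
  have a0: "0 \<le> ?a" by (rule scale_norm_bounds(2)[OF \<alpha>])
  have l0: "0 \<le> ?l" by (rule op_norm_nonneg[OF S L])
  have a1: "?a < 1"
  proof -
    have "words N \<noteq> {}" using replicate_words by blast
    then show ?thesis
      unfolding scale_norm_def using finite_words assms(4) by (subst Max_less_iff) auto
  qed
  have al: "?a * ?l < 1"
  proof -
    \<comment> \<open>For \<open>?l = 0\<close> the last hypothesis would bound the nonnegative \<open>?a\<close> strictly by \<open>inverse 0 = 0\<close>.\<close>
    have "?l \<noteq> 0" using assms(7) a0 by auto
    then have "?l > 0" using l0 by simp
    then show ?thesis using assms(7) by (simp add: field_simps)
  qed
  define R where "R f g \<longleftrightarrow> f \<in> cspace ?S \<and> g \<in> cspace ?S \<and> (\<forall>w\<in>words N. \<forall>y\<in>?S.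
    g (sg_word p w y) = f (sg_word p w y) + \<alpha> w y * (g y - L f y))" for f g
  have res: "sup_norm ?S (\<lambda>t\<in>?S. g t - L f t) \<le> sup_norm ?S g + ?l * sup_norm ?S f"
    if "f \<in> cspace ?S" "g \<in> cspace ?S" for f g
    using sup_norm_diff_le[OF S that(2) LC[OF that(1)]] sup_norm_le_op_norm[OF S L that(1)]
    by linarith
  show ?thesis
  proof (rule topological_isomorphism_linear_relation[OF S, where R = R])
    show "f \<in> cspace ?S \<and> g \<in> cspace ?S" if "R f g" for f g
      using that by (simp add: R_def)
    show "R (\<lambda>t\<in>?S. f t + f' t) (\<lambda>t\<in>?S. g t + g' t)" if "R f g" "R f' g'" for f f' g g'
      using that by (simp add: R_def L_add cspace_add sg_word_in_SG algebra_simps)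
    show "R (\<lambda>t\<in>?S. c * f t) (\<lambda>t\<in>?S. c * g t)" if "R f g" for c f g
      using that by (simp add: R_def L_scale cspace_scale sg_word_in_SG distrib_left
          mult.left_commute right_diff_distrib[symmetric])
  next
    fix f assume f: "f \<in> cspace ?S"
    have "\<exists>g\<in>cspace ?S. \<forall>w\<in>words N. \<forall>y\<in>?S.
        g (sg_word p w y) = f (sg_word p w y) + \<alpha> w y * (\<lambda>t\<in>?S. g t - L f t) y"
    proof (rule self_referential_solution[OF p \<alpha> f, where d = 1])
      fix g h assume g: "g \<in> cspace ?S" and h: "h \<in> cspace ?S"
      have "(\<lambda>t\<in>?S. (\<lambda>t\<in>?S. g t - L f t) t - (\<lambda>t\<in>?S. h t - L f t) t) = (\<lambda>t\<in>?S. g t - h t)"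
        by (auto simp: restrict_def)
      then show "sup_norm ?S (\<lambda>t\<in>?S. (\<lambda>t\<in>?S. g t - L f t) t - (\<lambda>t\<in>?S. h t - L f t) t)
          \<le> 1 * sup_norm ?S (\<lambda>t\<in>?S. g t - h t)"
        by simp
      show "(\<lambda>t\<in>?S. g t - L f t) \<in> cspace ?S"
        by (rule cspace_diff[OF g LC[OF f]])
      show "(\<lambda>t\<in>?S. g t - L f t) t = 0" if "\<And>t. t \<in> range p \<Longrightarrow> g t = f t" "t \<in> range p" for t
        using that(1)[OF that(2)] L0[OF f that(2)] vS[OF that(2)] by simp
    next
      show "?a * 1 < 1" using a1 by simp
    qed
    then show "\<exists>g. R f g"
      using f by (auto simp: R_def)
  next
    fix g assume g: "g \<in> cspace ?S"
    have "\<exists>f\<in>cspace ?S. \<forall>w\<in>words N. \<forall>y\<in>?S.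
        f (sg_word p w y) = g (sg_word p w y) + \<alpha> w y * (\<lambda>t\<in>?S. L f t - g t) y"
    proof (rule self_referential_solution[OF p \<alpha> g, where d = ?l])
      fix f h assume f: "f \<in> cspace ?S" and h: "h \<in> cspace ?S"
      have "L (\<lambda>t\<in>?S. f t - h t) = (\<lambda>t\<in>?S. (\<lambda>t\<in>?S. L f t - g t) t - (\<lambda>t\<in>?S. L h t - g t) t)"
        using bounded_linear_cspace_diff[OF L f h] LC[OF cspace_diff[OF f h]]
        by (intro cspace_eqI[of _ ?S] cspace_diff LC f h g) auto
      then show "sup_norm ?S (\<lambda>t\<in>?S. (\<lambda>t\<in>?S. L f t - g t) t - (\<lambda>t\<in>?S. L h t - g t) t)
          \<le> ?l * sup_norm ?S (\<lambda>t\<in>?S. f t - h t)"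
        using sup_norm_le_op_norm[OF S L cspace_diff[OF f h]] by simp
      show "(\<lambda>t\<in>?S. L f t - g t) \<in> cspace ?S"
        by (rule cspace_diff[OF LC[OF f] g])
      show "(\<lambda>t\<in>?S. L f t - g t) t = 0" if "\<And>t. t \<in> range p \<Longrightarrow> f t = g t" "t \<in> range p" for t
        using that(1)[OF that(2)] L0[OF f that(2)] vS[OF that(2)] by simp
    next
      show "?a * ?l < 1" by (rule al)
    qed
    then obtain f where f: "f \<in> cspace ?S"
      and eq: "\<And>w y. w \<in> words N \<Longrightarrow> y \<in> ?S \<Longrightarrow>
        f (sg_word p w y) = g (sg_word p w y) + \<alpha> w y * (L f y - g y)"
      by auto
    then have "R f g"
      using g by (simp add: R_def algebra_simps)
    then show "\<exists>f. R f g" by blast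
  next
    fix f g assume R: "R f g"
    then have f: "f \<in> cspace ?S" and g: "g \<in> cspace ?S" by (simp_all add: R_def)
    have "sup_norm ?S g \<le> sup_norm ?S f + ?a * sup_norm ?S (\<lambda>t\<in>?S. g t - L f t)"
      using R by (intro self_referential_sup_norm_le \<alpha> f cspace_diff g LC) (auto simp: R_def)
    also have "\<dots> \<le> sup_norm ?S f + ?a * (sup_norm ?S g + ?l * sup_norm ?S f)"
      by (intro add_left_mono mult_left_mono res f g a0)
    finally have "(1 - ?a) * sup_norm ?S g \<le> (1 + ?a * ?l) * sup_norm ?S f"
      by (simp add: algebra_simps)
    then show "sup_norm ?S g \<le> ((1 + ?a * ?l) / (1 - ?a)) * sup_norm ?S f"
      using a1 by (simp add: field_simps)
    have "sup_norm ?S f \<le> sup_norm ?S g + ?a * sup_norm ?S (\<lambda>t\<in>?S. L f t - g t)"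
      using R by (intro self_referential_sup_norm_le \<alpha> f cspace_diff g LC)
        (auto simp: R_def algebra_simps)
    also have "sup_norm ?S (\<lambda>t\<in>?S. L f t - g t) = sup_norm ?S (\<lambda>t\<in>?S. g t - L f t)"
      by (simp add: sup_norm_def abs_minus_commute)
    also have "sup_norm ?S g + ?a * \<dots> \<le> sup_norm ?S g + ?a * (sup_norm ?S g + ?l * sup_norm ?S f)"
      by (intro add_left_mono mult_left_mono res f g a0)
    finally have "(1 - ?a * ?l) * sup_norm ?S f \<le> (1 + ?a) * sup_norm ?S g"
      by (simp add: algebra_simps)
    then show "sup_norm ?S f \<le> ((1 + ?a) / (1 - ?a * ?l)) * sup_norm ?S g"
      using al by (simp add: field_simps)
  next
    fix f assume "f \<in> cspace ?S"
    then show "fractal_operator p N \<alpha> L f = (THE g. R f g)"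
      by (simp add: fractal_operator_def fractal_function_def R_def inv_sg_word)
  qed
qed

end
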